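(* Let $T_n$ be a model tree with root vertex $x_0$, and let $T\subseteq T_n$ be a (infinite, connected) subtree with $x_0\in T$. If $T_n$ is stochastically complete, then so is $T$.
   Context: All graphs are infinite, locally finite and connected; $d(x,y)$ is the number of edges in a shortest path from $x$ to $y$, $m(x)$ is the valence (number of edges at $x$), and $y\sim x$ means $x,y$ are joined by an edge. A tree is called model if it contains a vertex $x_0$, the root, such that the valence is constant on each sphere $S_r=\{x:d(x,x_0)=r\}$: $m(x)=m(r)$ for all $x\in S_r$. Its branching function is $n(r)=m(r)-1$ for $r>0$ and $n(0)=m(x_0)$, and the tree is denoted $T_n$. The combinatorial Laplacian is $\Delta f(x)=\sum_{y\sim x}(f(x)-f(y))$. The heat kernel $p_t(x,y)$ of a graph with vertex set $V$ is the smallest non-negative function on $V\times V\times[0,\infty)$ which is smooth in $t$, satisfies $\Delta p+\frac{\partial p}{\partial t}=0$ (with $\Delta$ in either vertex variable) and $p_0(x,y)=\delta_x(y)$. The graph is stochastically incomplete if $\sum_{y\in V}p_{t_0}(x_0,y)<1$ for some vertex $x_0$ and some $t_0>0$, and stochastically complete otherwise. *)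

theory Defs
  imports "HOL-Analysis.Analysis" "Graph_Theory.Digraph_Component"
begin

text \<open>
  A simple undirected graph is a loop-free symmetric digraph whose arcs are pairs of vertices
  (locale \<^locale>\<open>pair_bidirected_digraph\<close>, which imposes no finiteness): each edge
  is represented by its two orientations, so the valence of a vertex is its out-degree.
  The name \<^term>\<open>Digraph_Component.connected\<close> is qualified because HOL-Analysis
  also has a constant of that name.
\<close>

definition infinite_graph :: "'a pair_pre_digraph \<Rightarrow> bool" where
  "infinite_graph G \<longleftrightarrow>
     pair_bidirected_digraph G \<and>
     infinite (pverts G) \<and>
     (\<forall>x\<in>pverts G. finite (out_arcs (with_proj G) x)) \<and>
     Digraph_Component.connected (with_proj G)"

text \<open>
  An edge traversed back and forth is a \<^const>\<open>pre_digraph.cycle\<close> of length 2, so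
  \<^const>\<open>Digraph_Component.tree\<close> fails for every symmetric digraph with an edge. In a
  loop-free symmetric digraph the cycles of the undirected graph are exactly the cycles of
  length at least 3.
\<close>

definition infinite_tree :: "'a pair_pre_digraph \<Rightarrow> bool" where
  "infinite_tree G \<longleftrightarrow>
     infinite_graph G \<and> \<not> (\<exists>p. pre_digraph.cycle (with_proj G) p \<and> 3 \<le> length p)"

abbreviation valence :: "'a pair_pre_digraph \<Rightarrow> 'a \<Rightarrow> nat" where
  "valence G x \<equiv> out_degree (with_proj G) x"

definition graph_dist :: "'a pair_pre_digraph \<Rightarrow> 'a \<Rightarrow> 'a \<Rightarrow> nat" where
  "graph_dist G x y = (LEAST k. \<exists>p. pre_digraph.awalk (with_proj G) x p y \<and> length p = k)"

definition graph_sphere :: "'a pair_pre_digraph \<Rightarrow> 'a \<Rightarrow> nat \<Rightarrow> 'a set" where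
  "graph_sphere G x0 r = {x \<in> pverts G. graph_dist G x x0 = r}"

text \<open>
  \<open>model_tree G x0 n\<close>: \<open>G\<close> is a model tree with root \<open>x0\<close> and branching function \<open>n\<close>.
  The subtraction does not truncate: in an infinite connected locally finite graph all spheres
  are nonempty, and all valences are positive.
\<close>

definition model_tree :: "'a pair_pre_digraph \<Rightarrow> 'a \<Rightarrow> (nat \<Rightarrow> nat) \<Rightarrow> bool" where
  "model_tree G x0 n \<longleftrightarrow>
     infinite_tree G \<and> x0 \<in> pverts G \<and>
     (\<exists>m. (\<forall>r. \<forall>x\<in>graph_sphere G x0 r. valence G x = m r) \<and>
          (\<forall>r. n r = (if r = 0 then m 0 else m r - 1)))"

definition laplacian :: "'a pair_pre_digraph \<Rightarrow> ('a \<Rightarrow> real) \<Rightarrow> 'a \<Rightarrow> real" where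
  "laplacian G f x = (\<Sum>y | (x, y) \<in> parcs G. f x - f y)"

text \<open>
  Infinite differentiability on \<open>[0, \<infinity>)\<close>, with one-sided derivatives at \<open>0\<close>;
  \<open>D k\<close> is the \<open>k\<close>-th derivative.
\<close>

definition smooth_halfline :: "(real \<Rightarrow> real) \<Rightarrow> bool" where
  "smooth_halfline f \<longleftrightarrow>
     (\<exists>D :: nat \<Rightarrow> real \<Rightarrow> real.
        (\<forall>t\<ge>0. D 0 t = f t) \<and>
        (\<forall>k. \<forall>t\<ge>0. (D k has_real_derivative D (Suc k) t) (at t within {0..})))"

text \<open>
  Time is the last argument: \<open>p x y t\<close> stands for \<open>p\<^sub>t(x, y)\<close>. Only the
  values at vertices \<open>x\<close>, \<open>y\<close> and times \<open>t \<ge> 0\<close> matter.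
\<close>

definition heat_solution :: "'a pair_pre_digraph \<Rightarrow> ('a \<Rightarrow> 'a \<Rightarrow> real \<Rightarrow> real) \<Rightarrow> bool" where
  "heat_solution G p \<longleftrightarrow>
     (\<forall>x\<in>pverts G. \<forall>y\<in>pverts G.
        (\<forall>t\<ge>0. 0 \<le> p x y t) \<and>
        smooth_halfline (p x y) \<and>
        (\<forall>t\<ge>0. (p x y has_real_derivative - laplacian G (\<lambda>z. p z y t) x) (at t within {0..})) \<and>
        (\<forall>t\<ge>0. (p x y has_real_derivative - laplacian G (\<lambda>z. p x z t) y) (at t within {0..})) \<and>
        p x y 0 = (if x = y then 1 else 0))"

definition is_heat_kernel :: "'a pair_pre_digraph \<Rightarrow> ('a \<Rightarrow> 'a \<Rightarrow> real \<Rightarrow> real) \<Rightarrow> bool" where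
  "is_heat_kernel G p \<longleftrightarrow>
     heat_solution G p \<and>
     (\<forall>q. heat_solution G q \<longrightarrow>
        (\<forall>x\<in>pverts G. \<forall>y\<in>pverts G. \<forall>t\<ge>0. p x y t \<le> q x y t))"

text \<open>
  Two heat kernels agree at all vertices and all times \<open>t \<ge> 0\<close>, so the choice only
  concerns values outside this domain.
\<close>

definition heat_kernel :: "'a pair_pre_digraph \<Rightarrow> 'a \<Rightarrow> 'a \<Rightarrow> real \<Rightarrow> real" where
  "heat_kernel G = (SOME p. is_heat_kernel G p)"

text \<open>
  The sum is taken in \<^typ>\<open>ennreal\<close>, since a real-valued \<^const>\<open>infsum\<close>
  would be \<open>0\<close> if it diverged.
\<close>

definition stochastically_incomplete :: "'a pair_pre_digraph \<Rightarrow> bool" where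
  "stochastically_incomplete G \<longleftrightarrow>
     (\<exists>x0\<in>pverts G. \<exists>t0>0. (\<Sum>\<^sub>\<infinity>y\<in>pverts G. ennreal (heat_kernel G x0 y t0)) < 1)"

definition stochastically_complete :: "'a pair_pre_digraph \<Rightarrow> bool" where
  "stochastically_complete G \<longleftrightarrow> \<not> stochastically_incomplete G"

end

theory Submission
  imports Defs
begin

text \<open>
  Let \<open>v\<close> be the radial solution of \<open>\<Delta> v + v = 0\<close> on the model tree with value \<open>1\<close> at the root; it is
  nondecreasing in the distance to the root. The heat kernel is the increasing limit of the Dirichlet
  heat kernels of finite balls, so everything follows from the minimum principle on finite sets.
  If \<open>v\<close> were bounded with supremum \<open>M\<close>, then \<open>2 - e\<^sup>t v / M\<close> would be a nonnegative supersolution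
  of the heat equation up to time \<open>ln 2\<close>, starting above \<open>1\<close>; it dominates the total heat, yet is below
  \<open>1\<close> at time \<open>ln 2\<close> where \<open>v > M / 2\<close>, so \<open>T\<^sub>n\<close> would lose heat. Hence \<open>v\<close> tends to infinity. In \<open>T\<close>
  every vertex keeps its parent and has at most as many children as in \<open>T\<^sub>n\<close>, so \<open>\<Delta> v + v \<ge> 0\<close> still
  holds on \<open>T\<close>, and comparing the heat lost from the ball \<open>{v < C}\<close> with \<open>e\<^sup>t v / C\<close> and letting \<open>C\<close>
  grow shows that no heat is lost.
\<close>

section \<open>The Laplacian of a locally finite graph\<close>

text \<open>A quadratic error bound survives pointwise limits, whereas differentiability need not.
  This turns the bound inherited by a limit back into a derivative.\<close>

lemma has_real_derivative_if_quadratic: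
  fixes g :: "real \<Rightarrow> real"
  assumes "\<And>z. z \<in> S \<Longrightarrow> \<bar>g z - g w - D * (z - w)\<bar> \<le> C * (z - w)\<^sup>2"
  shows "(g has_real_derivative D) (at w within S)"
  unfolding has_field_derivative_iff
proof (rule Lim_null[THEN iffD2], rule Lim_null_comparison)
  show "\<forall>\<^sub>F z in at w within S. norm ((g z - g w) / (z - w) - D) \<le> C * \<bar>z - w\<bar>"
    unfolding eventually_at_filter
  proof (intro always_eventually allI impI)
    fix z assume "z \<noteq> w" "z \<in> S"
    then have "(g z - g w) / (z - w) - D = (g z - g w - D * (z - w)) / (z - w)"
      by (simp add: field_simps)
    moreover have "(z - w)\<^sup>2 = \<bar>z - w\<bar> * \<bar>z - w\<bar>"
      by (simp add: power2_eq_square)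
    ultimately show "norm ((g z - g w) / (z - w) - D) \<le> C * \<bar>z - w\<bar>"
      using assms[OF \<open>z \<in> S\<close>] \<open>z \<noteq> w\<close> by (simp add: pos_divide_le_eq mult.assoc)
  qed
  have "((\<lambda>z. C * \<bar>z - w\<bar>) \<longlongrightarrow> C * \<bar>w - w\<bar>) (at w within S)"
    by (intro tendsto_intros)
  then show "((\<lambda>z. C * \<bar>z - w\<bar>) \<longlongrightarrow> 0) (at w within S)" by simp
qed

locale locally_finite_graph = pair_sym_digraph G for G :: "'a pair_pre_digraph" +
  assumes finite_nbrs: "finite {y. (x, y) \<in> parcs G}"
begin

abbreviation nbrs :: "'a \<Rightarrow> 'a set" where
  "nbrs x \<equiv> {y. (x, y) \<in> parcs G}"

lemma arc_sym: "(x, y) \<in> parcs G \<longleftrightarrow> (y, x) \<in> parcs G"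
  using pair_sym_arcs by (auto simp: symmetric_def dest: symD)

lemma laplacian_alt: "laplacian G f x = real (card (nbrs x)) * f x - (\<Sum>y\<in>nbrs x. f y)"
  by (simp add: laplacian_def sum_subtractf)

lemma laplacian_has_derivative:
  assumes "\<And>y. y = x \<or> y \<in> nbrs x \<Longrightarrow> ((\<lambda>t. f y t) has_real_derivative f' y) F"
  shows "((\<lambda>t. laplacian G (\<lambda>y. f y t) x) has_real_derivative laplacian G f' x) F"
  unfolding laplacian_def using assms by (auto intro!: derivative_intros)

lemma abs_laplacian_le:
  assumes "\<And>y. y = x \<or> y \<in> nbrs x \<Longrightarrow> \<bar>f y\<bar> \<le> C"
  shows "\<bar>laplacian G f x\<bar> \<le> 2 * real (card (nbrs x)) * C"
proof -
  have "\<bar>laplacian G f x\<bar> \<le> (\<Sum>y\<in>nbrs x. \<bar>f x - f y\<bar>)"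
    unfolding laplacian_def by (rule sum_abs)
  also have "\<dots> \<le> (\<Sum>y\<in>nbrs x. 2 * C)"
    using assms by (intro sum_mono) (smt (verit))
  finally show ?thesis by simp
qed

lemma laplacian_add: "laplacian G (\<lambda>x. f x + g x) x = laplacian G f x + laplacian G g x"
  by (simp add: laplacian_def sum.distrib algebra_simps sum_subtractf)

lemma laplacian_diff: "laplacian G (\<lambda>x. f x - g x) x = laplacian G f x - laplacian G g x"
  by (simp add: laplacian_def algebra_simps sum.distrib sum_subtractf)

lemma laplacian_cmult: "laplacian G (\<lambda>x. c * f x) x = c * laplacian G f x"
  by (simp add: laplacian_def sum_distrib_left algebra_simps)

lemma laplacian_const: "laplacian G (\<lambda>x. c) x = 0"
  by (simp add: laplacian_def)

lemma laplacian_sum: "laplacian G (\<lambda>x. \<Sum>i\<in>I. f i x) x = (\<Sum>i\<in>I. laplacian G (f i) x)"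
  unfolding laplacian_def by (subst sum.swap) (simp add: sum_subtractf)

section \<open>Dirichlet heat kernels of finite sets\<close>

text \<open>Add a small multiple of time and take the minimum over \<open>B\<close> and [0, T]. If
  it were negative, it would occur at a positive time and no neighbour would have a smaller value.
  The Laplacian would then be at most 0 and the time derivative positive, so a slightly earlier
  value would be smaller.\<close>

lemma minimum_principle:
  assumes B: "finite B"
    and der: "\<And>x t. x \<in> B \<Longrightarrow> 0 \<le> t \<Longrightarrow> t \<le> T \<Longrightarrow>
        (u x has_real_derivative u' x t) (at t within {0..})"
    and super: "\<And>x t. x \<in> B \<Longrightarrow> 0 \<le> t \<Longrightarrow> t \<le> T \<Longrightarrow> 0 \<le> u' x t + laplacian G (\<lambda>z. u z t) x"
    and init: "\<And>x. x \<in> B \<Longrightarrow> 0 \<le> u x 0"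
    and bdry: "\<And>y t. y \<notin> B \<Longrightarrow> y \<in> pverts G \<Longrightarrow> 0 \<le> t \<Longrightarrow> t \<le> T \<Longrightarrow> 0 \<le> u y t"
    and x: "x \<in> B" and t: "0 \<le> t" "t \<le> T"
  shows "0 \<le> u x t"
proof (rule field_le_epsilon)
  fix e :: real assume "0 < e"
  \<comment> \<open>The perturbation stays at most \<open>e\<close> on [0, T]; the denominator
    \<open>T + 1\<close> is positive even for T = 0.\<close>
  define \<epsilon> where "\<epsilon> = e / (T + 1)"
  have eps: "0 < \<epsilon>" "\<epsilon> * T \<le> e" using \<open>0 < e\<close> t by (auto simp: \<epsilon>_def field_simps)
  define w where "w x t = u x t + \<epsilon> * t" for x t
  have "\<exists>s\<in>{0..T}. \<forall>s'\<in>{0..T}. w y s \<le> w y s'" if "y \<in> B" for y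
  proof (rule continuous_attains_inf)
    have "continuous_on {0..T} (u y)"
      unfolding continuous_on_eq_continuous_within
      by (auto intro!: DERIV_continuous[OF DERIV_subset[OF der[OF that]]])
    then show "continuous_on {0..T} (w y)"
      unfolding w_def by (intro continuous_intros)
  qed (use t in auto)
  then obtain \<tau> where \<tau>: "\<And>y. y \<in> B \<Longrightarrow> \<tau> y \<in> {0..T}"
    "\<And>y s. y \<in> B \<Longrightarrow> s \<in> {0..T} \<Longrightarrow> w y (\<tau> y) \<le> w y s"
    by metis
  obtain z where z: "z \<in> B" "\<And>y. y \<in> B \<Longrightarrow> w z (\<tau> z) \<le> w y (\<tau> y)"
    using ex_is_arg_min_if_finite[of B "\<lambda>y. w y (\<tau> y)"] B x
    by (auto simp: is_arg_min_linorder)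
  define s where "s = \<tau> z"
  have s: "0 \<le> s" "s \<le> T" using \<tau>(1)[OF z(1)] by (auto simp: s_def)
  have min: "w z s \<le> w y r" if "y \<in> B" "0 \<le> r" "r \<le> T" for y r
    using z(2)[OF that(1)] \<tau>(2)[of y r] that by (auto simp: s_def)
  have "0 \<le> w z s"
  proof (rule ccontr)
    assume neg: "\<not> 0 \<le> w z s"
    have "s \<noteq> 0" using neg init[OF z(1)] by (auto simp: w_def)
    with s have "0 < s" by simp
    have "u z s \<le> u y s" if "(z, y) \<in> parcs G" for y
    proof (cases "y \<in> B")
      case True
      then show ?thesis using min[OF True s] by (simp add: w_def)
    next
      case False
      have "u z s < 0" using neg eps(1) s by (simp add: w_def) (smt (verit) mult_nonneg_nonneg)
      then show ?thesis using bdry[OF False in_arcsD2[OF that] s] by simp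
    qed
    then have "laplacian G (\<lambda>z. u z s) z \<le> 0"
      unfolding laplacian_def by (intro sum_nonpos) auto
    then have "0 < u' z s + \<epsilon>" using super[OF z(1) s] eps by simp
    moreover have "(w z has_real_derivative u' z s + \<epsilon>) (at s)"
    proof -
      \<comment> \<open>At a positive time the derivative is two-sided, so it also controls earlier
        values.\<close>
      have "at s within {0..} = at s"
        using \<open>0 < s\<close> by (intro at_within_interior) (simp add: interior_Ici[where x = "-1"])
      then show ?thesis
        using der[OF z(1) s] unfolding w_def by (auto intro!: derivative_eq_intros)
    qed
    ultimately obtain d where d: "0 < d" "\<And>h. 0 < h \<Longrightarrow> h < d \<Longrightarrow> w z (s - h) < w z s"
      using DERIV_pos_inc_left by metis
    \<comment> \<open>Capping the step by \<open>s\<close> keeps the earlier time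
      nonnegative.\<close>
    have "w z (s - min (d / 2) s) < w z s"
      using d(1) \<open>0 < s\<close> by (intro d(2)) auto
    moreover have "w z s \<le> w z (s - min (d / 2) s)"
      using d(1) s by (intro min z) auto
    ultimately show False by simp
  qed
  also have "w z s \<le> w x t" using min[OF x t] .
  also have "\<epsilon> * t \<le> \<epsilon> * T"
    using t(2) eps(1) by (intro mult_left_mono) auto
  then have "w x t \<le> u x t + e"
    using eps(2) by (simp add: w_def)
  finally show "0 \<le> u x t + e" .
qed

text \<open>
  With \<open>R = rate B\<close>, the Dirichlet Laplacian of \<open>B\<close> is \<open>R - step B\<close>, where the matrix \<open>step B\<close> has nonnegative
  entries and row sums at most \<open>R\<close>. The heat semigroup is thus \<open>e\<^bsup>-Rt\<^esup>\<close> times the exponential series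
  of \<open>t step B\<close>.
\<close>

definition rate :: "'a set \<Rightarrow> real" where
  "rate B = (\<Sum>x\<in>B. real (card (nbrs x)))"

definition step :: "'a set \<Rightarrow> 'a \<Rightarrow> 'a \<Rightarrow> real" where
  "step B x z = (if x = z then rate B - real (card (nbrs x)) else 0) + of_bool ((x, z) \<in> parcs G)"

primrec steps :: "'a set \<Rightarrow> nat \<Rightarrow> 'a \<Rightarrow> 'a \<Rightarrow> real" where
  "steps B 0 x y = of_bool (x = y)"
| "steps B (Suc k) x y = (\<Sum>z\<in>B. step B x z * steps B k z y)"

lemma rate_nonneg: "0 \<le> rate B"
  by (simp add: rate_def sum_nonneg)

text \<open>The sum of the valences serves as a crude bound for each of them, which makes the
  diagonal of \<open>step\<close> nonnegative.\<close>

lemma card_nbrs_le_rate: "finite B \<Longrightarrow> x \<in> B \<Longrightarrow> real (card (nbrs x)) \<le> rate B"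
  unfolding rate_def by (rule member_le_sum) auto

lemma step_nonneg: "finite B \<Longrightarrow> x \<in> B \<Longrightarrow> 0 \<le> step B x z"
  using card_nbrs_le_rate by (auto simp: step_def)

lemma step_sym: "step B x y = step B y x"
  using arc_sym by (auto simp: step_def)

lemma sum_step:
  assumes "finite B" "x \<in> B"
  shows "(\<Sum>z\<in>B. step B x z * f z) =
    (rate B - real (card (nbrs x))) * f x + (\<Sum>z\<in>nbrs x \<inter> B. f z)"
proof -
  have "(\<Sum>z\<in>B. step B x z * f z) =
      (\<Sum>z\<in>B. (if x = z then (rate B - real (card (nbrs x))) * f z else 0)
          + (if z \<in> nbrs x then f z else 0))"
    by (intro sum.cong) (auto simp: step_def algebra_simps)
  also have "\<dots> = (rate B - real (card (nbrs x))) * f x + (\<Sum>z\<in>B \<inter> nbrs x. f z)"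
    using assms by (subst sum.distrib) (simp add: sum.inter_restrict)
  finally show ?thesis by (simp add: Int_commute)
qed

lemma sum_step_le_rate:
  assumes "finite B" "x \<in> B"
  shows "(\<Sum>z\<in>B. step B x z) \<le> rate B"
proof -
  have "card (nbrs x \<inter> B) \<le> card (nbrs x)"
    by (intro card_mono finite_nbrs) auto
  then show ?thesis using sum_step[OF assms, of "\<lambda>_. 1"] by simp
qed

text \<open>Neighbours outside \<open>B\<close> contribute nothing when \<open>f\<close> vanishes
  there, so the finite matrix acts through the Laplacian of the whole graph.\<close>

lemma sum_step_eq_laplacian:
  assumes "finite B" "x \<in> B" "\<And>z. z \<notin> B \<Longrightarrow> f z = 0"
  shows "(\<Sum>z\<in>B. step B x z * f z) = rate B * f x - laplacian G f x"
proof -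
  have "(\<Sum>z\<in>nbrs x \<inter> B. f z) = (\<Sum>z\<in>nbrs x. f z)"
    using assms(3) by (intro sum.mono_neutral_left finite_nbrs) auto
  then show ?thesis
    unfolding sum_step[OF assms(1,2)] laplacian_alt by (simp add: algebra_simps)
qed

text \<open>The recursion splits off the first factor of the matrix power; splitting off the last
  one is what the induction for symmetry requires.\<close>

lemma steps_Suc_right:
  assumes "finite B" "x \<in> B" "y \<in> B"
  shows "steps B (Suc k) x y = (\<Sum>z\<in>B. steps B k x z * step B z y)"
  using assms(2)
proof (induction k arbitrary: x)
  case 0
  then show ?case
    using assms
    by (simp add: of_bool_def if_distrib[of "\<lambda>c. c * _"] if_distrib[of "\<lambda>c. _ * c"] cong: if_cong)
next
  case (Suc k)
  have "steps B (Suc (Suc k)) x y = (\<Sum>z\<in>B. step B x z * (\<Sum>w\<in>B. steps B k z w * step B w y))"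
    using Suc.IH by (subst steps.simps(2)) (auto intro!: sum.cong simp del: steps.simps)
  also have "\<dots> = (\<Sum>w\<in>B. (\<Sum>z\<in>B. step B x z * steps B k z w) * step B w y)"
    unfolding sum_distrib_left sum_distrib_right by (subst sum.swap) (simp add: mult_ac)
  finally show ?case by simp
qed

lemma steps_sym:
  assumes "finite B" "x \<in> B" "y \<in> B"
  shows "steps B k x y = steps B k y x"
  using assms(2,3)
proof (induction k arbitrary: x y)
  case (Suc k)
  have "steps B (Suc k) x y = (\<Sum>z\<in>B. steps B k x z * step B z y)"
    by (rule steps_Suc_right) fact+
  also have "\<dots> = (\<Sum>z\<in>B. step B y z * steps B k z x)"
    using Suc by (intro sum.cong refl) (simp add: step_sym mult.commute)
  finally show ?case by simp
qed auto

lemma steps_nonneg: "finite B \<Longrightarrow> x \<in> B \<Longrightarrow> 0 \<le> steps B k x y"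
  by (induction k arbitrary: x) (auto intro!: sum_nonneg mult_nonneg_nonneg step_nonneg)

text \<open>The row sums are at most \<open>rate B\<close>. This geometric bound gives both the
  convergence of the exponential series and the bound 1 on the kernel.\<close>

lemma steps_le:
  assumes "finite B" "x \<in> B"
  shows "steps B k x y \<le> rate B ^ k"
  using assms(2)
proof (induction k arbitrary: x)
  case (Suc k)
  have "steps B (Suc k) x y \<le> (\<Sum>z\<in>B. step B x z * rate B ^ k)"
    using Suc assms by (auto intro!: sum_mono mult_left_mono step_nonneg)
  also have "\<dots> \<le> rate B * rate B ^ k"
    using sum_step_le_rate[OF assms(1) Suc.prems] rate_nonneg
    by (simp flip: sum_distrib_right add: mult_right_mono)
  finally show ?case by simp
qed auto

text \<open>Extension by zero encodes the Dirichlet condition and lets \<open>laplacian G\<close> be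
  applied directly.\<close>

definition dirichlet_kernel :: "'a set \<Rightarrow> 'a \<Rightarrow> 'a \<Rightarrow> real \<Rightarrow> real" where
  "dirichlet_kernel B x y t =
     (if x \<in> B \<and> y \<in> B then exp (- rate B * t) * (\<Sum>k. steps B k x y / fact k * t ^ k) else 0)"

lemma dirichlet_kernel_outside: "x \<notin> B \<or> y \<notin> B \<Longrightarrow> dirichlet_kernel B x y t = 0"
  by (auto simp: dirichlet_kernel_def)

lemma steps_series_summable:
  assumes "finite B" "x \<in> B"
  shows "summable (\<lambda>k. steps B k x y / fact k * (t::real) ^ k)"
proof (rule summable_comparison_test')
  show "summable (\<lambda>k. inverse (fact k) * (rate B * \<bar>t\<bar>) ^ k)"
    by (rule summable_exp)
  show "norm (steps B k x y / fact k * t ^ k) \<le> inverse (fact k) * (rate B * \<bar>t\<bar>) ^ k"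
    if "0 \<le> k" for k
    using steps_le[OF assms, of k y] steps_nonneg[OF assms, of k y]
    by (simp add: abs_mult power_abs power_mult_distrib field_simps mult_left_mono)
qed

lemma dirichlet_kernel_sym:
  assumes "finite B"
  shows "dirichlet_kernel B x y t = dirichlet_kernel B y x t"
  using steps_sym[OF assms] by (simp add: dirichlet_kernel_def)

lemma dirichlet_kernel_0:
  assumes "x \<in> B"
  shows "dirichlet_kernel B x y 0 = of_bool (x = y)"
  using assms powser_zero[of "\<lambda>k. steps B k x y / fact k"]
  by (auto simp: dirichlet_kernel_def)

lemma dirichlet_kernel_nonneg:
  assumes "finite B" "0 \<le> t"
  shows "0 \<le> dirichlet_kernel B x y t"
  using assms steps_nonneg[OF assms(1)]
  unfolding dirichlet_kernel_def
  by (simp add: mult_nonneg_nonneg suminf_nonneg steps_series_summable del: times_divide_eq_left)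

text \<open>By \<open>steps_le\<close> the series is at most \<open>exp (rate B * t)\<close>, which
  the prefactor cancels.\<close>

lemma dirichlet_kernel_le_1:
  assumes "finite B" "0 \<le> t"
  shows "dirichlet_kernel B x y t \<le> 1"
proof (cases "x \<in> B \<and> y \<in> B")
  case True
  have "(\<Sum>k. steps B k x y / fact k * t ^ k) \<le> (\<Sum>k. inverse (fact k) * (rate B * t) ^ k)"
    using True assms steps_le[OF assms(1), of x _ y]
    by (intro suminf_le steps_series_summable summable_exp)
       (auto simp: field_simps power_mult_distrib intro!: mult_left_mono)
  also have "\<dots> = exp (rate B * t)"
    by (simp add: exp_def scaleR_conv_of_real)
  finally show ?thesis
    using True by (simp add: dirichlet_kernel_def exp_minus field_simps)
qed (auto simp: dirichlet_kernel_def)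

text \<open>Termwise differentiation shifts the index and so applies \<open>step B\<close> once. The
  prefactor contributes \<open>- rate B\<close>, which leaves exactly the negative
  Laplacian.\<close>

lemma dirichlet_kernel_derivative:
  assumes "finite B" "x \<in> B"
  shows "(dirichlet_kernel B x y has_real_derivative
    - laplacian G (\<lambda>z. dirichlet_kernel B z y t) x) (at t within S)"
proof (cases "y \<in> B")
  case True
  define g where "g z t = (\<Sum>k. steps B k z y / fact k * t ^ k)" for z and t :: real
  have "(g x has_real_derivative (\<Sum>k. diffs (\<lambda>k. steps B k x y / fact k) k * t ^ k)) (at t)"
    unfolding g_def
    by (rule termdiffs_strong_converges_everywhere[OF steps_series_summable[OF assms]])
  also have "(\<Sum>k. diffs (\<lambda>k. steps B k x y / fact k) k * t ^ k) =
      (\<Sum>k. \<Sum>z\<in>B. step B x z * (steps B k z y / fact k * t ^ k))"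
    by (intro suminf_cong)
       (simp add: diffs_def sum_distrib_left sum_distrib_right sum_divide_distrib fact_Suc mult_ac
         del: of_nat_Suc)
  also have "\<dots> = (\<Sum>z\<in>B. step B x z * g z t)"
    unfolding g_def using steps_series_summable[OF assms(1)]
    by (subst suminf_sum)
       (auto intro!: sum.cong suminf_mult summable_mult simp del: times_divide_eq_left times_divide_eq_right)
  finally have g: "(g x has_real_derivative (\<Sum>z\<in>B. step B x z * g z t)) (at t)" .
  have D: "dirichlet_kernel B z y t = exp (- rate B * t) * g z t" if "z \<in> B" for z t
    using that True by (simp add: dirichlet_kernel_def g_def)
  have "((\<lambda>t. exp (- rate B * t) * g x t) has_real_derivative
      exp (- rate B * t) * (\<Sum>z\<in>B. step B x z * g z t) - rate B * (exp (- rate B * t) * g x t)) (at t)"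
    by (auto intro!: derivative_eq_intros g)
  also have "exp (- rate B * t) * (\<Sum>z\<in>B. step B x z * g z t) =
      (\<Sum>z\<in>B. step B x z * dirichlet_kernel B z y t)"
    by (simp add: sum_distrib_left D mult_ac cong: sum.cong)
  also have "\<dots> = rate B * dirichlet_kernel B x y t - laplacian G (\<lambda>z. dirichlet_kernel B z y t) x"
    by (rule sum_step_eq_laplacian[OF assms]) (simp add: dirichlet_kernel_outside)
  finally have "((\<lambda>t. exp (- rate B * t) * g x t) has_real_derivative
      - laplacian G (\<lambda>z. dirichlet_kernel B z y t) x) (at t)"
    by (simp add: D[OF assms(2)])
  moreover have "dirichlet_kernel B x y = (\<lambda>t. exp (- rate B * t) * g x t)"
    using D[OF assms(2)] by auto
  ultimately show ?thesis
    by (simp add: has_field_derivative_at_within)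
next
  case False
  then have "dirichlet_kernel B z y = (\<lambda>_. 0)" for z
    by (simp add: dirichlet_kernel_outside fun_eq_iff)
  then show ?thesis by (simp add: laplacian_def)
qed

text \<open>The difference solves the heat equation on \<open>B\<close>, starts at 0 and is
  nonnegative outside \<open>B\<close>, where the kernel vanishes. As \<open>q\<close> has to solve
  the equation on \<open>B\<close> only, it may be a heat solution or the Dirichlet kernel of a
  larger set.\<close>

lemma dirichlet_kernel_le:
  fixes q :: "'a \<Rightarrow> real \<Rightarrow> real"
  assumes B: "finite B" "B \<subseteq> pverts G" and t: "0 \<le> t"
    and der: "\<And>z s. z \<in> B \<Longrightarrow> 0 \<le> s \<Longrightarrow>
        (q z has_real_derivative - laplacian G (\<lambda>z. q z s) z) (at s within {0..})"
    and nonneg: "\<And>z s. z \<in> pverts G \<Longrightarrow> 0 \<le> s \<Longrightarrow> 0 \<le> q z s"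
    and init: "\<And>z. z \<in> B \<Longrightarrow> q z 0 = of_bool (z = y)"
    and x: "x \<in> pverts G"
  shows "dirichlet_kernel B x y t \<le> q x t"
proof (cases "x \<in> B")
  case True
  have "0 \<le> q x t - dirichlet_kernel B x y t"
  proof (rule minimum_principle[where u = "\<lambda>z s. q z s - dirichlet_kernel B z y s" and T = t
      and u' = "\<lambda>z s. - laplacian G (\<lambda>z. q z s) z + laplacian G (\<lambda>z. dirichlet_kernel B z y s) z"])
    fix z and s :: real assume z: "z \<in> B" "0 \<le> s"
    show "((\<lambda>s. q z s - dirichlet_kernel B z y s) has_real_derivative
        - laplacian G (\<lambda>z. q z s) z + laplacian G (\<lambda>z. dirichlet_kernel B z y s) z) (at s within {0..})"
      using DERIV_diff[OF der[OF z] dirichlet_kernel_derivative[OF B(1) z(1), of y s "{0..}"]] by simp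
  qed (use B t True nonneg in \<open>auto simp: init dirichlet_kernel_0 dirichlet_kernel_outside laplacian_diff\<close>)
  then show ?thesis by simp
qed (use nonneg x t in \<open>simp add: dirichlet_kernel_outside\<close>)

lemma dirichlet_kernel_mono:
  assumes "finite B'" "B \<subseteq> B'" "B' \<subseteq> pverts G" "0 \<le> t"
  shows "dirichlet_kernel B x y t \<le> dirichlet_kernel B' x y t"
proof (cases "x \<in> B")
  case True
  show ?thesis
  proof (rule dirichlet_kernel_le[where q = "\<lambda>z. dirichlet_kernel B' z y"])
    show "finite B" using assms(1,2) finite_subset by blast
    show "x \<in> pverts G" using True assms(2,3) by blast
    show "(dirichlet_kernel B' z y has_real_derivative
        - laplacian G (\<lambda>z. dirichlet_kernel B' z y s) z) (at s within {0..})" if "z \<in> B" for z s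
      using that assms(2) by (intro dirichlet_kernel_derivative assms(1)) auto
    show "dirichlet_kernel B' z y 0 = of_bool (z = y)" if "z \<in> B" for z
      using that assms(2) by (intro dirichlet_kernel_0) auto
  qed (use assms dirichlet_kernel_nonneg in auto)
qed (use assms in \<open>simp add: dirichlet_kernel_outside dirichlet_kernel_nonneg\<close>)

text \<open>As a function of \<open>x\<close> and \<open>t\<close> this is the Dirichlet heat flow
  started from the constant 1; its deficit from 1 is the heat lost through the boundary.\<close>

definition dirichlet_mass :: "'a set \<Rightarrow> 'a \<Rightarrow> real \<Rightarrow> real" where
  "dirichlet_mass B x t = (\<Sum>y\<in>B. dirichlet_kernel B x y t)"

lemma dirichlet_mass_outside: "x \<notin> B \<Longrightarrow> dirichlet_mass B x t = 0"
  by (simp add: dirichlet_mass_def dirichlet_kernel_outside)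

lemma dirichlet_mass_0: "finite B \<Longrightarrow> x \<in> B \<Longrightarrow> dirichlet_mass B x 0 = 1"
  by (simp add: dirichlet_mass_def dirichlet_kernel_0 of_bool_def cong: if_cong)

lemma dirichlet_mass_derivative:
  assumes "finite B" "x \<in> B"
  shows "(dirichlet_mass B x has_real_derivative - laplacian G (\<lambda>z. dirichlet_mass B z t) x)
    (at t within S)"
  unfolding dirichlet_mass_def laplacian_sum
  by (auto intro!: derivative_eq_intros dirichlet_kernel_derivative[OF assms] simp: sum_negf)

end

section \<open>The heat kernel as a limit of Dirichlet heat kernels\<close>

text \<open>The exhaustion is left arbitrary so that a subtree can be exhausted by depth in the
  surrounding tree.\<close>

locale exhausted_graph = locally_finite_graph +
  fixes B :: "nat \<Rightarrow> 'a set"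
  assumes finite_B: "finite (B k)" and incseq_B: "incseq B" and Union_B: "(\<Union>k. B k) = pverts G"
begin

lemma B_subset: "B k \<subseteq> pverts G"
  using Union_B by auto

lemma finite_subset_B:
  assumes "finite F" "F \<subseteq> pverts G"
  shows "\<forall>\<^sub>F k in sequentially. F \<subseteq> B k"
proof -
  have "\<forall>\<^sub>F k in sequentially. x \<in> B k" if "x \<in> F" for x
    using that assms Union_B incseq_B unfolding eventually_sequentially incseq_def by blast
  then have "\<forall>\<^sub>F k in sequentially. \<forall>x\<in>F. x \<in> B k"
    using assms(1) by (simp add: eventually_ball_finite)
  then show ?thesis by (rule eventually_mono) auto
qed

definition min_kernel :: "'a \<Rightarrow> 'a \<Rightarrow> real \<Rightarrow> real" where
  "min_kernel x y t = (SUP k. dirichlet_kernel (B k) x y t)"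

lemma min_kernel_tendsto:
  assumes "0 \<le> t"
  shows "(\<lambda>k. dirichlet_kernel (B k) x y t) \<longlonglongrightarrow> min_kernel x y t"
  unfolding min_kernel_def
proof (rule LIMSEQ_incseq_SUP)
  show "bdd_above (range (\<lambda>k. dirichlet_kernel (B k) x y t))"
    using dirichlet_kernel_le_1[OF finite_B assms] by (intro bdd_aboveI[of _ 1]) auto
  show "incseq (\<lambda>k. dirichlet_kernel (B k) x y t)"
    by (intro incseq_SucI dirichlet_kernel_mono incseq_SucD[OF incseq_B] B_subset finite_B assms)
qed

lemma dirichlet_kernel_le_min_kernel:
  assumes "0 \<le> t"
  shows "dirichlet_kernel (B k) x y t \<le> min_kernel x y t"
  unfolding min_kernel_def
  using dirichlet_kernel_le_1[OF finite_B assms] by (intro cSUP_upper bdd_aboveI[of _ 1]) auto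

lemma min_kernel_nonneg: "0 \<le> t \<Longrightarrow> 0 \<le> min_kernel x y t"
  using order_trans[OF dirichlet_kernel_nonneg[OF finite_B] dirichlet_kernel_le_min_kernel] .

lemma min_kernel_sym: "min_kernel x y t = min_kernel y x t"
  unfolding min_kernel_def by (subst dirichlet_kernel_sym[OF finite_B]) simp

lemma min_kernel_0:
  assumes "x \<in> pverts G"
  shows "min_kernel x y 0 = of_bool (x = y)"
proof (rule LIMSEQ_unique[OF min_kernel_tendsto tendsto_eventually])
  show "\<forall>\<^sub>F k in sequentially. dirichlet_kernel (B k) x y 0 = of_bool (x = y)"
    using finite_subset_B[of "{x}"] assms by (auto elim!: eventually_mono simp: dirichlet_kernel_0)
qed simp

text \<open>
  Local finiteness bounds the second time derivatives of the Dirichlet kernels at a vertex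
  uniformly in \<open>k\<close>, so their Taylor estimates survive the limit.
\<close>

lemma min_kernel_derivative:
  assumes "0 \<le> t"
  shows "(min_kernel x y has_real_derivative - laplacian G (\<lambda>z. min_kernel z y t) x)
    (at t within {0..})"
proof (cases "x \<in> pverts G")
  case True
  \<comment> \<open>The second time derivative is the Laplacian applied twice to values in [0, 1].
    The sum over \<open>x\<close> and its neighbours replaces a maximum.\<close>
  define C where "C = 2 * real (card (nbrs x)) * (\<Sum>z\<in>insert x (nbrs x). 2 * real (card (nbrs z)))"
  let ?p = "\<lambda>k z s. dirichlet_kernel (B k) z y s"
  have lim: "(\<lambda>k. laplacian G (\<lambda>z. ?p k z t) x) \<longlonglongrightarrow> laplacian G (\<lambda>z. min_kernel z y t) x"
    unfolding laplacian_def by (intro tendsto_intros min_kernel_tendsto assms)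
  have bound: "\<forall>\<^sub>F k in sequentially.
      \<bar>?p k x s - ?p k x t - (- laplacian G (\<lambda>z. ?p k z t) x) * (s - t)\<bar> \<le> C * (s - t)\<^sup>2"
    if "0 \<le> s" for s
  proof -
    have "\<forall>\<^sub>F k in sequentially. insert x (nbrs x) \<subseteq> B k"
      using True finite_nbrs in_arcsD2 by (intro finite_subset_B) auto
    then show ?thesis
    proof eventually_elim
      case (elim k)
      have p: "(?p k z has_real_derivative - laplacian G (\<lambda>z. ?p k z r) z) (at r within S)"
        if "z = x \<or> z \<in> nbrs x" for z r S
        using elim that by (intro dirichlet_kernel_derivative finite_B) auto
      \<comment> \<open>The kernel and its first two time derivatives, as the Taylor estimate
        expects them.\<close>
      define f where "f i r = (if i = 0 then ?p k x r
          else if i = 1 then - laplacian G (\<lambda>z. ?p k z r) x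
          else - laplacian G (\<lambda>z. - laplacian G (\<lambda>z. ?p k z r) z) x)" for i :: nat and r
      have "norm (f 0 s - (\<Sum>i\<le>1. f i t * (s - t) ^ i / fact i)) \<le> C * norm (s - t) ^ Suc 1 / fact 1"
      proof (rule field_Taylor[where S = "{0..}"])
        fix i :: nat and r :: real
        assume "r \<in> {0..}" "i \<le> 1"
        then consider "i = 0" | "i = 1" by linarith
        then show "(f i has_real_derivative f (Suc i) r) (at r within {0..})"
        proof cases
          case 1
          moreover have "f 0 = ?p k x" by (simp add: f_def fun_eq_iff)
          ultimately show ?thesis using p by (simp add: f_def)
        next
          case 2
          then show ?thesis
            unfolding f_def by (auto intro!: DERIV_minus laplacian_has_derivative p)
        qed
      next
        fix r :: real assume r: "r \<in> {0..}"
        have "\<bar>- laplacian G (\<lambda>z. ?p k z r) z\<bar> \<le> (\<Sum>z\<in>insert x (nbrs x). 2 * real (card (nbrs z)))"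
          if z: "z = x \<or> z \<in> nbrs x" for z
        proof -
          have "\<bar>laplacian G (\<lambda>z. ?p k z r) z\<bar> \<le> 2 * real (card (nbrs z)) * 1"
            using r dirichlet_kernel_le_1[OF finite_B] dirichlet_kernel_nonneg[OF finite_B]
            by (intro abs_laplacian_le) auto
          also have "\<dots> \<le> (\<Sum>z\<in>insert x (nbrs x). 2 * real (card (nbrs z)))"
            using z finite_nbrs
              member_le_sum[of z "insert x (nbrs x)" "\<lambda>z. 2 * real (card (nbrs z))"] by auto
          finally show ?thesis by simp
        qed
        from abs_laplacian_le[OF this] show "norm (f (Suc 1) r) \<le> C"
          by (simp add: f_def C_def)
      qed (use assms that in auto)
      then show ?case
        by (simp add: f_def power2_eq_square algebra_simps abs_mult_self_eq)
    qed
  qed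
  show ?thesis
  proof (rule has_real_derivative_if_quadratic[where C = C])
    fix s :: real assume "s \<in> {0..}"
    then have s: "0 \<le> s" by simp
    have "(\<lambda>k. \<bar>?p k x s - ?p k x t - (- laplacian G (\<lambda>z. ?p k z t) x) * (s - t)\<bar>) \<longlonglongrightarrow>
        \<bar>min_kernel x y s - min_kernel x y t - (- laplacian G (\<lambda>z. min_kernel z y t) x) * (s - t)\<bar>"
      by (intro tendsto_intros lim min_kernel_tendsto assms s)
    from tendsto_upperbound[OF this bound[OF s]]
    show "\<bar>min_kernel x y s - min_kernel x y t - (- laplacian G (\<lambda>z. min_kernel z y t) x) * (s - t)\<bar>
        \<le> C * (s - t)\<^sup>2" by simp
  qed
next
  case False
  then have "x \<notin> B k" for k using B_subset by auto
  then have "min_kernel x y = (\<lambda>_. 0)"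
    by (simp add: min_kernel_def dirichlet_kernel_outside fun_eq_iff)
  moreover have "nbrs x = {}" using False in_arcsD1 by auto
  ultimately show ?thesis by (simp add: laplacian_def)
qed

text \<open>Each time derivative is a finite combination of values at neighbouring vertices, so the
  heat equation can be differentiated again. The induction runs over all vertices at once.\<close>

lemma min_kernel_smooth: "smooth_halfline (min_kernel x y)"
proof -
  define D where "D k t = ((\<lambda>f z. - laplacian G f z) ^^ k) (\<lambda>z. min_kernel z y t)" for k t
  have D_0: "D 0 t z = min_kernel z y t" and D_Suc: "D (Suc k) t z = - laplacian G (D k t) z" for k t z
    by (simp_all add: D_def)
  have "((\<lambda>t. D k t z) has_real_derivative D (Suc k) t z) (at t within {0..})" if "0 \<le> t" for k t z
  proof (induction k arbitrary: z)
    case 0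
    show ?case
      using min_kernel_derivative[OF that, of z y] unfolding D_Suc D_0 by (simp add: D_0[abs_def])
  next
    case (Suc k)
    have "((\<lambda>t. laplacian G (\<lambda>z. D k t z) z) has_real_derivative laplacian G (D (Suc k) t) z)
        (at t within {0..})"
      by (rule laplacian_has_derivative) (rule Suc.IH)
    then show ?case unfolding D_Suc by (rule DERIV_minus)
  qed
  then show ?thesis
    unfolding smooth_halfline_def by (intro exI[of _ "\<lambda>k t. D k t x"]) (simp add: D_0)
qed

lemma heat_solution_min_kernel: "heat_solution G min_kernel"
  unfolding heat_solution_def
proof (intro ballI conjI allI impI)
  fix x y and t :: real
  assume t: "0 \<le> t"
  \<comment> \<open>Symmetry transfers the equation from the first vertex variable to the
    second.\<close>
  have "min_kernel y x = min_kernel x y" and "(\<lambda>z. min_kernel z x t) = (\<lambda>z. min_kernel x z t)"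
    by (rule ext, rule min_kernel_sym)+
  then show "(min_kernel x y has_real_derivative - laplacian G (\<lambda>z. min_kernel x z t) y)
      (at t within {0..})"
    using min_kernel_derivative[OF t, of y x] by simp
next
  show "min_kernel x y 0 = (if x = y then 1 else 0)" if "x \<in> pverts G" for x y
    using min_kernel_0[OF that, of y] by simp
qed (rule min_kernel_derivative min_kernel_nonneg min_kernel_smooth; assumption)+

lemma min_kernel_le:
  assumes q: "heat_solution G q" and xy: "x \<in> pverts G" "y \<in> pverts G" and t: "0 \<le> t"
  shows "min_kernel x y t \<le> q x y t"
proof (rule LIMSEQ_le_const2[OF min_kernel_tendsto[OF t]], intro exI allI impI)
  fix k
  have q': "(\<forall>t\<ge>0. 0 \<le> q z y t) \<and> (\<forall>t\<ge>0. (q z y has_real_derivative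
      - laplacian G (\<lambda>z. q z y t) z) (at t within {0..})) \<and> q z y 0 = of_bool (z = y)"
    if "z \<in> pverts G" for z
    using q that xy(2) unfolding heat_solution_def of_bool_def by blast
  show "dirichlet_kernel (B k) x y t \<le> q x y t"
  proof (rule dirichlet_kernel_le[where q = "\<lambda>x. q x y", OF finite_B B_subset t])
    fix z and s :: real assume "z \<in> B k" "0 \<le> s"
    then show "(q z y has_real_derivative - laplacian G (\<lambda>z. q z y s) z) (at s within {0..})"
      using q'[of z] B_subset[of k] by blast
  qed (use q' B_subset[of k] xy in blast)+
qed

lemma is_heat_kernel_min_kernel: "is_heat_kernel G min_kernel"
  unfolding is_heat_kernel_def using heat_solution_min_kernel min_kernel_le by blast

text \<open>Existence makes the choice in \<open>heat_kernel\<close> meaningful, and two minimal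
  solutions bound each other.\<close>

lemma heat_kernel_eq:
  assumes "x \<in> pverts G" "y \<in> pverts G" "0 \<le> t"
  shows "heat_kernel G x y t = min_kernel x y t"
proof -
  have "is_heat_kernel G (heat_kernel G)"
    unfolding heat_kernel_def
    using someI[of "is_heat_kernel G", OF is_heat_kernel_min_kernel] .
  with is_heat_kernel_min_kernel show ?thesis
    using assms unfolding is_heat_kernel_def by (intro antisym) blast+
qed

section \<open>Total heat, and criteria for completeness and incompleteness\<close>

lemma heat_kernel_mass_ge:
  assumes "x \<in> pverts G" "0 \<le> t"
  shows "ennreal (dirichlet_mass (B k) x t) \<le> (\<Sum>\<^sub>\<infinity>y\<in>pverts G. ennreal (heat_kernel G x y t))"
proof -
  have "ennreal (dirichlet_mass (B k) x t) = (\<Sum>y\<in>B k. ennreal (dirichlet_kernel (B k) x y t))"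
    unfolding dirichlet_mass_def using dirichlet_kernel_nonneg[OF finite_B assms(2)]
    by (simp add: sum_ennreal)
  also have "\<dots> \<le> (\<Sum>y\<in>B k. ennreal (heat_kernel G x y t))"
    using B_subset[of k] assms
    by (intro sum_mono ennreal_leI) (auto simp: heat_kernel_eq dirichlet_kernel_le_min_kernel)
  also have "\<dots> \<le> (\<Sum>\<^sub>\<infinity>y\<in>pverts G. ennreal (heat_kernel G x y t))"
    using B_subset finite_B by (subst nonneg_infsum_complete) (auto intro!: SUP_upper)
  finally show ?thesis .
qed

text \<open>The infinite sum is a supremum over finite sets \<open>F\<close>. For fixed
  \<open>F\<close> the limit in \<open>k\<close> commutes with the sum, and eventually
  \<open>B k\<close> contains \<open>F\<close> and \<open>x\<close>.\<close>

lemma heat_kernel_mass_le: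
  assumes x: "x \<in> pverts G" and t: "0 \<le> t" and c: "\<And>k. x \<in> B k \<Longrightarrow> dirichlet_mass (B k) x t \<le> c"
  shows "(\<Sum>\<^sub>\<infinity>y\<in>pverts G. ennreal (heat_kernel G x y t)) \<le> ennreal c"
  unfolding nonneg_infsum_complete[OF zero_le]
proof (rule SUP_least)
  fix F assume F: "F \<in> {F. finite F \<and> F \<subseteq> pverts G}"
  have "(\<Sum>y\<in>F. min_kernel x y t) \<le> c"
  proof (rule tendsto_upperbound)
    show "(\<lambda>k. \<Sum>y\<in>F. dirichlet_kernel (B k) x y t) \<longlonglongrightarrow> (\<Sum>y\<in>F. min_kernel x y t)"
      by (intro tendsto_intros min_kernel_tendsto t)
    show "\<forall>\<^sub>F k in sequentially. (\<Sum>y\<in>F. dirichlet_kernel (B k) x y t) \<le> c"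
    proof -
      have "\<forall>\<^sub>F k in sequentially. insert x F \<subseteq> B k"
        using F x by (intro finite_subset_B) auto
      then show ?thesis
      proof eventually_elim
        case (elim k)
        then have "(\<Sum>y\<in>F. dirichlet_kernel (B k) x y t) \<le> dirichlet_mass (B k) x t"
          unfolding dirichlet_mass_def
          by (intro sum_mono2 finite_B dirichlet_kernel_nonneg t) auto
        with c[of k] elim show ?case by auto
      qed
    qed
  qed simp
  moreover have "(\<Sum>y\<in>F. ennreal (heat_kernel G x y t)) = (\<Sum>y\<in>F. ennreal (min_kernel x y t))"
    using F by (intro sum.cong refl) (auto simp: heat_kernel_eq x t)
  then have "(\<Sum>y\<in>F. ennreal (heat_kernel G x y t)) = ennreal (\<Sum>y\<in>F. min_kernel x y t)"
    by (simp add: sum_ennreal min_kernel_nonneg t)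
  ultimately show "(\<Sum>y\<in>F. ennreal (heat_kernel G x y t)) \<le> ennreal c"
    by (simp add: ennreal_leI)
qed

text \<open>Where \<open>f\<close> is at least \<open>C\<close> outside \<open>B k\<close>, the heat
  lost from \<open>B k\<close> is at most \<open>exp t * f x / C\<close> by the minimum principle.
  This tends to 0 as \<open>C\<close> grows.\<close>

lemma stochastically_complete_if_exhaustive_supersolution:
  assumes nonneg: "\<And>x. x \<in> pverts G \<Longrightarrow> 0 \<le> f x"
    and super: "\<And>x. x \<in> pverts G \<Longrightarrow> 0 \<le> laplacian G f x + f x"
    and exhaustive: "\<And>C. \<exists>k. \<forall>x\<in>pverts G - B k. C \<le> f x"
  shows "stochastically_complete G"
  unfolding stochastically_complete_def stochastically_incomplete_def
proof safe
  fix x and t :: real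
  assume x: "x \<in> pverts G" and t: "0 < t"
    and less: "(\<Sum>\<^sub>\<infinity>y\<in>pverts G. ennreal (heat_kernel G x y t)) < 1"
  then obtain r where r: "(\<Sum>\<^sub>\<infinity>y\<in>pverts G. ennreal (heat_kernel G x y t)) = ennreal r" "0 \<le> r"
    by (cases "\<Sum>\<^sub>\<infinity>y\<in>pverts G. ennreal (heat_kernel G x y t)") auto
  with less have "r < 1" by (simp add: ennreal_less_one_iff)
  \<comment> \<open>Chosen to make \<open>exp t * f x / C\<close> smaller than the assumed loss
    \<open>1 - r\<close>; the summand 1 gives strictness and positivity.\<close>
  define C where "C = (exp t * f x + 1) / (1 - r)"
  have "0 < exp t * f x + 1"
    using nonneg[OF x] by (smt (verit) mult_nonneg_nonneg exp_ge_zero)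
  then have C: "0 < C" "exp t * f x < C * (1 - r)"
    using \<open>r < 1\<close> by (auto simp: C_def)
  obtain k where k: "\<And>z. z \<in> pverts G \<Longrightarrow> z \<notin> B k \<Longrightarrow> C \<le> f z"
    using exhaustive[of C] by auto
  have "dirichlet_mass (B k) x t \<le> r"
    using heat_kernel_mass_ge[OF x, of t k] t r by simp
  moreover have "0 \<le> dirichlet_mass (B k) x t - 1 + exp t / C * f x"
  proof (cases "x \<in> B k")
    case True
    show ?thesis
    proof (rule minimum_principle[where u = "\<lambda>z s. dirichlet_mass (B k) z s - 1 + exp s / C * f z"
        and T = t and u' = "\<lambda>z s. - laplacian G (\<lambda>z. dirichlet_mass (B k) z s) z + exp s / C * f z"])
      show "finite (B k)" by (rule finite_B)
    next
      fix z and s :: real assume "z \<in> B k"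
      then show "((\<lambda>s. dirichlet_mass (B k) z s - 1 + exp s / C * f z) has_real_derivative
          - laplacian G (\<lambda>z. dirichlet_mass (B k) z s) z + exp s / C * f z) (at s within {0..})"
        using C by (auto intro!: derivative_eq_intros dirichlet_mass_derivative finite_B)
    next
      fix z and s :: real assume "z \<in> B k"
      then have "0 \<le> exp s / C * (laplacian G f z + f z)"
        using super[of z] B_subset[of k] C by (intro mult_nonneg_nonneg) auto
      then show "0 \<le> - laplacian G (\<lambda>z. dirichlet_mass (B k) z s) z + exp s / C * f z
          + laplacian G (\<lambda>z. dirichlet_mass (B k) z s - 1 + exp s / C * f z) z"
        using laplacian_cmult[of "exp s / C" f z]
        by (simp add: laplacian_add laplacian_diff laplacian_const ring_distribs)
    next
      fix z assume "z \<in> B k"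
      then show "0 \<le> dirichlet_mass (B k) z 0 - 1 + exp 0 / C * f z"
        using nonneg[of z] B_subset[of k] C by (auto simp: dirichlet_mass_0 finite_B)
    next
      fix z and s :: real assume z: "z \<notin> B k" "z \<in> pverts G" and s: "0 \<le> s"
      have "1 * C \<le> exp s * f z"
        using k[OF z(2,1)] s C by (intro mult_mono) auto
      then show "0 \<le> dirichlet_mass (B k) z s - 1 + exp s / C * f z"
        using z C by (simp add: dirichlet_mass_outside field_simps)
    qed (use t True in auto)
  next
    case False
    have "1 * C \<le> exp t * f x"
      using k[OF x False] t C by (intro mult_mono) auto
    then show ?thesis using False C by (simp add: dirichlet_mass_outside field_simps)
  qed
  ultimately have "1 - r \<le> exp t * f x / C" by simp
  then show False using C by (simp add: field_simps)
qed

text \<open>The barrier \<open>2 - exp s * f / M\<close> starts at 1 or above and stays nonnegative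
  while \<open>exp s\<close> is at most 2, so it dominates the Dirichlet mass of every
  \<open>B k\<close> uniformly.\<close>

lemma stochastically_incomplete_if_bounded_subsolution:
  assumes nonneg: "\<And>x. x \<in> pverts G \<Longrightarrow> 0 \<le> f x"
    and sub: "\<And>x. x \<in> pverts G \<Longrightarrow> laplacian G f x + f x \<le> 0"
    and bounded: "bdd_above (f ` pverts G)"
    and pos: "w \<in> pverts G" "0 < f w"
  shows "stochastically_incomplete G"
proof -
  define M where "M = (SUP x\<in>pverts G. f x)"
  have le_M: "f x \<le> M" if "x \<in> pverts G" for x
    unfolding M_def using bounded that by (rule cSUP_upper2) auto
  have M: "0 < M" using le_M[OF pos(1)] pos(2) by simp
  then have "M / 2 < M" by simp
  then obtain x where x: "x \<in> pverts G" "M / 2 < f x"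
    using less_cSUP_iff[OF _ bounded, of "M / 2"] pos(1) unfolding M_def by auto
  \<comment> \<open>The last time at which the barrier is sure to be nonnegative; there its value at
    \<open>x\<close> is below 1.\<close>
  define t :: real where "t = ln 2"
  have t: "0 < t" "exp t = 2" by (auto simp: t_def)
  have "dirichlet_mass (B k) x t \<le> 2 - exp t / M * f x" if "x \<in> B k" for k
  proof -
    have "0 \<le> 2 - exp t / M * f x - dirichlet_mass (B k) x t"
    proof (rule minimum_principle[where u = "\<lambda>z s. 2 - exp s / M * f z - dirichlet_mass (B k) z s"
        and T = t and u' = "\<lambda>z s. - (exp s / M * f z) + laplacian G (\<lambda>z. dirichlet_mass (B k) z s) z"])
      show "finite (B k)" by (rule finite_B)
    next
      fix z and s :: real assume "z \<in> B k"
      then show "((\<lambda>s. 2 - exp s / M * f z - dirichlet_mass (B k) z s) has_real_derivative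
          - (exp s / M * f z) + laplacian G (\<lambda>z. dirichlet_mass (B k) z s) z) (at s within {0..})"
        using M by (auto intro!: derivative_eq_intros dirichlet_mass_derivative finite_B)
    next
      fix z and s :: real assume "z \<in> B k"
      then have "exp s / M * (laplacian G f z + f z) \<le> 0"
        using sub[of z] B_subset[of k] M by (intro mult_nonneg_nonpos) auto
      then show "0 \<le> - (exp s / M * f z) + laplacian G (\<lambda>z. dirichlet_mass (B k) z s) z
          + laplacian G (\<lambda>z. 2 - exp s / M * f z - dirichlet_mass (B k) z s) z"
        using laplacian_cmult[of "exp s / M" f z]
        by (simp add: laplacian_diff laplacian_const ring_distribs)
    next
      fix z assume "z \<in> B k"
      then show "0 \<le> 2 - exp 0 / M * f z - dirichlet_mass (B k) z 0"
        using le_M[of z] B_subset[of k] M by (auto simp: dirichlet_mass_0 finite_B field_simps)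
    next
      fix z and s :: real assume z: "z \<notin> B k" "z \<in> pverts G" and s: "0 \<le> s" "s \<le> t"
      have "exp s * f z \<le> 2 * M"
        using le_M[OF z(2)] nonneg[OF z(2)] s(2) t(2) by (intro mult_mono) (auto simp flip: t(2))
      then show "0 \<le> 2 - exp s / M * f z - dirichlet_mass (B k) z s"
        using z M by (simp add: dirichlet_mass_outside field_simps)
    qed (use t that in auto)
    then show ?thesis by simp
  qed
  from heat_kernel_mass_le[OF x(1) _ this] t(1)
  have "(\<Sum>\<^sub>\<infinity>y\<in>pverts G. ennreal (heat_kernel G x y t)) \<le> ennreal (2 - exp t / M * f x)" by simp
  also have "2 - exp t / M * f x < 1"
    using x(2) M t(2) by (simp add: field_simps)
  then have "ennreal (2 - exp t / M * f x) < 1" by (simp add: ennreal_less_one_iff)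
  finally show ?thesis
    unfolding stochastically_incomplete_def using x(1) t(1) by blast
qed

end

section \<open>Trees\<close>

locale rooted_tree = locally_finite_graph +
  fixes x0 :: 'a
  assumes root: "x0 \<in> pverts G"
    and no_loop: "(x, x) \<notin> parcs G"
    and connected_to_root: "x \<in> pverts G \<Longrightarrow> (x, x0) \<in> (parcs G)\<^sup>*"
    and no_long_cycle: "cycle p \<Longrightarrow> length p < 3"
begin

abbreviation depth :: "'a \<Rightarrow> nat" where
  "depth x \<equiv> graph_dist G x x0"

text \<open>The subrelation \<open>R\<close> records which arcs the walk uses, so that a walk can be
  forced to avoid a vertex.\<close>

lemma rtrancl_imp_awalk:
  assumes "(x, y) \<in> R\<^sup>*" "R \<subseteq> parcs G" "y \<in> pverts G"
  shows "\<exists>p. awalk x p y \<and> set p \<subseteq> R"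
  using assms(1)
proof (induction rule: converse_rtrancl_induct)
  case base
  show ?case using assms(3) by (intro exI[of _ "[]"]) (simp add: awalk_Nil_iff)
next
  case (step x z)
  then obtain p where "awalk z p y" "set p \<subseteq> R" by blast
  then show ?case
    using step(1) assms(2) in_arcsD1[of x z]
    by (intro exI[of _ "(x, z) # p"]) (auto simp: awalk_Cons_iff)
qed

lemma ex_geodesic:
  assumes "x \<in> pverts G"
  shows "\<exists>p. awalk x p x0 \<and> length p = depth x"
proof -
  obtain p where "awalk x p x0"
    using rtrancl_imp_awalk[OF connected_to_root[OF assms] subset_refl root] by blast
  then have "\<exists>k p. awalk x p x0 \<and> length p = k" by blast
  from LeastI_ex[OF this] show ?thesis unfolding graph_dist_def .
qed

lemma depth_le: "awalk x p x0 \<Longrightarrow> depth x \<le> length p"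
  unfolding graph_dist_def by (rule Least_le) blast

lemma depth_root: "depth x0 = 0"
  using depth_le[of x0 "[]"] root by (simp add: awalk_Nil_iff)

lemma depth_eq_0_iff:
  assumes "x \<in> pverts G"
  shows "depth x = 0 \<longleftrightarrow> x = x0"
  using ex_geodesic[OF assms] depth_root by (auto simp: awalk_Nil_iff)

lemma depth_arc_le:
  assumes "(x, y) \<in> parcs G"
  shows "depth x \<le> Suc (depth y)"
proof -
  obtain p where "awalk y p x0" "length p = depth y"
    using ex_geodesic in_arcsD2[OF assms] by blast
  then show ?thesis
    using depth_le[of x "(x, y) # p"] assms in_arcsD1[OF assms] by (simp add: awalk_Cons_iff)
qed

text \<open>The second vertex of a geodesic to the root works.\<close>

lemma parent_exists:
  assumes "x \<in> pverts G" "x \<noteq> x0"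
  shows "\<exists>a. (x, a) \<in> parcs G \<and> depth x = Suc (depth a)"
proof -
  obtain p where p: "awalk x p x0" "length p = depth x"
    using ex_geodesic[OF assms(1)] by blast
  with assms(2) obtain e q where "p = e # q" by (cases p) (auto simp: awalk_Nil_iff)
  with p have e: "e \<in> parcs G" "fst e = x" and q: "awalk (snd e) q x0" "Suc (length q) = depth x"
    by (auto simp: awalk_Cons_iff)
  from e have arc: "(x, snd e) \<in> parcs G" by (metis prod.collapse)
  then show ?thesis
    using depth_le[OF q(1)] q(2) depth_arc_le[OF arc] by (intro exI[of _ "snd e"]) simp
qed

text \<open>Pass from parent to parent: after the first step the depth is smaller than that of
  \<open>x\<close>, so \<open>x\<close> is never met.\<close>

lemma connected_to_root_avoiding:
  assumes "y \<in> pverts G" "y \<noteq> x" "depth y \<le> depth x"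
  shows "(y, x0) \<in> {(u, v) \<in> parcs G. u \<noteq> x \<and> v \<noteq> x}\<^sup>*"
  using assms
proof (induction "depth y" arbitrary: y rule: less_induct)
  case less
  show ?case
  proof (cases "y = x0")
    case False
    then obtain a where a: "(y, a) \<in> parcs G" "depth y = Suc (depth a)"
      using parent_exists less.prems(1) by blast
    then have "a \<noteq> x" using less.prems(3) by auto
    with less.hyps[of a] less.prems a have "(a, x0) \<in> {(u, v) \<in> parcs G. u \<noteq> x \<and> v \<noteq> x}\<^sup>*"
      using in_arcsD2 by auto
    moreover have "(y, a) \<in> {(u, v) \<in> parcs G. u \<noteq> x \<and> v \<noteq> x}"
      using a(1) \<open>a \<noteq> x\<close> less.prems(2) by simp
    ultimately show ?thesis by (rule converse_rtrancl_into_rtrancl[rotated])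
  qed simp
qed

text \<open>
  Two neighbours of \<open>x\<close> that are not further away from the root than \<open>x\<close> are joined by a path
  avoiding \<open>x\<close>, which together with \<open>x\<close> would form a cycle.
\<close>

lemma parent_unique:
  assumes a: "(x, a) \<in> parcs G" "depth a \<le> depth x" and b: "(x, b) \<in> parcs G" "depth b \<le> depth x"
  shows "a = b"
proof (rule ccontr)
  assume "a \<noteq> b"
  define R where "R = {(u, v) \<in> parcs G. u \<noteq> x \<and> v \<noteq> x}"
  have ne: "a \<noteq> x" "b \<noteq> x" using a b no_loop by auto
  have "(a, x0) \<in> R\<^sup>*" "(b, x0) \<in> R\<^sup>*"
    unfolding R_def using a b ne in_arcsD2 by (auto intro!: connected_to_root_avoiding)
  moreover have "sym (R\<^sup>*)"
    by (rule sym_rtrancl) (use arc_sym in \<open>auto simp: R_def sym_def\<close>)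
  ultimately have "(a, b) \<in> R\<^sup>*" by (meson rtrancl_trans symD)
  then obtain p where p: "awalk a p b" "set p \<subseteq> R"
    using rtrancl_imp_awalk[of a b R] in_arcsD2[OF b(1)] by (auto simp: R_def)
  \<comment> \<open>Shortcutting the walk makes its vertices distinct and introduces no new
    arcs.\<close>
  define q where "q = awalk_to_apath p"
  have q: "awalk a q b" "distinct (awalk_verts a q)" "set q \<subseteq> R"
    using apath_awalk_to_apath[OF p(1)] awalk_to_apath_subset[OF p(1)] p(2)
    by (auto simp: q_def apath_def)
  have "q \<noteq> []" using q(1) \<open>a \<noteq> b\<close> by (auto simp: awalk_Nil_iff)
  let ?c = "(x, a) # q @ [(b, x)]"
  have bx: "(b, x) \<in> parcs G" using b(1) arc_sym by blast
  have "awalk b [(b, x)] x"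
    using bx in_arcsD1[OF bx] in_arcsD2[OF bx] by (simp add: awalk_Cons_iff awalk_Nil_iff)
  then have qx: "awalk a (q @ [(b, x)]) x" using q(1) by (rule awalk_appendI[rotated])
  then have "awalk x ?c x"
    using a(1) in_arcsD1[OF a(1)] q(1) by (simp add: awalk_Cons_iff)
  moreover have "awalk_verts a (q @ [(b, x)]) = awalk_verts a q @ [x]"
    using q(1) by (subst awalk_verts_append[OF qx]) auto
  \<comment> \<open>Every vertex of the nonempty path \<open>q\<close> is an end of one of its arcs,
    and these avoid \<open>x\<close>.\<close>
  moreover have "last q \<in> R" using q(3) last_in_set[OF \<open>q \<noteq> []\<close>] by blast
  then have "x \<notin> set (awalk_verts a q)"
    using q(3) \<open>q \<noteq> []\<close> by (auto simp: awalk_verts_conv R_def)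
  ultimately have "cycle ?c"
    unfolding cycle_def using q(2) by (intro exI[of _ x]) simp
  from no_long_cycle[OF this] \<open>q \<noteq> []\<close> show False by (cases q) auto
qed

text \<open>If \<open>y\<close> is no deeper than \<open>x\<close>, then uniqueness identifies it
  with the parent of \<open>x\<close>; in particular equal depths cannot occur.\<close>

lemma depth_arc_cases:
  assumes "(x, y) \<in> parcs G"
  shows "depth x = Suc (depth y) \<or> depth y = Suc (depth x)"
proof (cases "depth y \<le> depth x")
  case True
  have "x \<noteq> x0"
    using True assms in_arcsD2[OF assms] depth_root depth_eq_0_iff no_loop by auto
  then obtain a where "(x, a) \<in> parcs G" "depth x = Suc (depth a)"
    using parent_exists in_arcsD1[OF assms] by blast
  with parent_unique[OF assms True, of a] show ?thesis by auto
next
  case False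
  then show ?thesis
    using depth_arc_le[of y x] assms arc_sym by force
qed

text \<open>All members of \<open>N\<close> except the parent \<open>a\<close> are children.
  Allowing a subset of the neighbours covers the Laplacians of the model tree and of the subtree
  together.\<close>

lemma sum_radial_diff:
  fixes g :: "nat \<Rightarrow> real"
  assumes N: "finite N" "N \<subseteq> nbrs x" and a: "a \<in> N" "depth x = Suc (depth a)"
  shows "(\<Sum>y\<in>N. g (depth x) - g (depth y)) =
    g (depth x) - g (depth x - 1) - real (card N - 1) * (g (Suc (depth x)) - g (depth x))"
proof -
  have "depth y = Suc (depth x)" if "y \<in> N - {a}" for y
  proof -
    have "(x, y) \<in> parcs G" "(x, a) \<in> parcs G" "y \<noteq> a" using that N a by auto
    then show ?thesis
      using depth_arc_cases[of x y] parent_unique[of x y a] a(2) by force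
  qed
  then have "(\<Sum>y\<in>N - {a}. g (depth x) - g (depth y)) =
      (\<Sum>y\<in>N - {a}. g (depth x) - g (Suc (depth x)))"
    by (intro sum.cong) auto
  then show ?thesis
    using a N(1) by (simp add: sum.remove[of N a] algebra_simps)
qed

lemma sum_radial_diff_root:
  fixes g :: "nat \<Rightarrow> real"
  assumes "N \<subseteq> nbrs x0"
  shows "(\<Sum>y\<in>N. g (depth x0) - g (depth y)) = - real (card N) * (g 1 - g 0)"
proof -
  have "depth y = Suc 0" if "y \<in> N" for y
    using depth_arc_cases[of x0 y] assms that depth_root by auto
  then have "(\<Sum>y\<in>N. g (depth x0) - g (depth y)) = (\<Sum>y\<in>N. g 0 - g 1)"
    by (intro sum.cong) (auto simp: depth_root)
  then show ?thesis by (simp add: algebra_simps)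
qed

lemma finite_depth_less: "finite {x \<in> pverts G. depth x < k}"
proof (induction k)
  case (Suc k)
  have "{x \<in> pverts G. depth x < Suc k} \<subseteq> {x0} \<union> (\<Union>a\<in>{x \<in> pverts G. depth x < k}. nbrs a)"
  proof
    fix x assume x: "x \<in> {x \<in> pverts G. depth x < Suc k}"
    show "x \<in> {x0} \<union> (\<Union>a\<in>{x \<in> pverts G. depth x < k}. nbrs a)"
    proof (cases "x = x0")
      case False
      then obtain a where "(x, a) \<in> parcs G" "depth x = Suc (depth a)"
        using parent_exists x by blast
      then show ?thesis using x in_arcsD2[of x a] arc_sym[of x a] by auto
    qed simp
  qed
  then show ?case
    by (rule finite_subset) (use Suc.IH finite_nbrs in auto)
qed simp

text \<open>Balls are finite, so some vertex is at least as deep as required; its ancestors take all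
  smaller depths.\<close>

lemma ex_depth:
  assumes "infinite (pverts G)"
  shows "\<exists>x\<in>pverts G. depth x = r"
proof -
  have "\<exists>y\<in>pverts G. depth y = r" if "x \<in> pverts G" "depth x = r + k" for x k
    using that
  proof (induction k arbitrary: x)
    case (Suc k)
    then have "x \<noteq> x0" using depth_root by auto
    then obtain a where "(x, a) \<in> parcs G" "depth x = Suc (depth a)"
      using parent_exists Suc.prems(1) by blast
    then show ?case using Suc.IH[of a] Suc.prems(2) in_arcsD2 by auto
  qed auto
  moreover have "\<exists>x\<in>pverts G. r \<le> depth x"
  proof (rule ccontr)
    assume "\<not> ?thesis"
    then have "pverts G = {x \<in> pverts G. depth x < r}" by auto
    with finite_depth_less[of r] assms show False by simp
  qed
  ultimately show ?thesis using le_iff_add by metis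
qed

text \<open>
  Follow an \<open>R\<close>-walk from \<open>x\<close> to the root: it can leave the set of descendants of \<open>x\<close> only
  through the arc from \<open>x\<close> to its parent.
\<close>

lemma parent_in_subgraph:
  assumes R: "R \<subseteq> parcs G" and walk: "(x, x0) \<in> R\<^sup>*" and x: "x \<noteq> x0"
  shows "\<exists>a. (x, a) \<in> R \<and> depth x = Suc (depth a)"
proof -
  define P where "P = {(u, v) \<in> parcs G. depth u = Suc (depth v)}"
  \<comment> \<open>For the induction along the walk, \<open>x\<close> is generalised to any
    descendant \<open>w\<close>, from which a chain of parent arcs leads to
    \<open>x\<close>.\<close>
  have "(w, x) \<in> P\<^sup>* \<Longrightarrow> ?thesis" if "(w, x0) \<in> R\<^sup>*" for w
    using that
  proof (induction rule: converse_rtrancl_induct)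
    case base
    then show ?case
      using x depth_root by (auto elim: converse_rtranclE simp: P_def)
  next
    case (step w w')
    have arc: "(w, w') \<in> parcs G" using step(1) R by auto
    show ?case
    proof (cases "depth w = Suc (depth w')")
      case True
      show ?thesis
      proof (cases "w = x")
        case True
        then show ?thesis using \<open>depth w = Suc (depth w')\<close> step.hyps(1) by blast
      next
        case False
        with step.prems obtain w'' where w'': "(w, w'') \<in> P" "(w'', x) \<in> P\<^sup>*"
          by (meson converse_rtranclE)
        then have "(w, w'') \<in> parcs G" "depth w = Suc (depth w'')" by (simp_all add: P_def)
        \<comment> \<open>The walk moves to the parent, which is unique and hence the next vertex of
          the chain to \<open>x\<close>.\<close>
        then have "w'' = w'"
          using parent_unique[of w w'' w'] arc True by linarith
        then show ?thesis using step.IH w''(2) by simp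
      qed
    next
      case False
      then have "(w', w) \<in> P"
        using depth_arc_cases[OF arc] arc arc_sym by (auto simp: P_def)
      then show ?thesis
        using step.IH step.prems by (meson converse_rtrancl_into_rtrancl)
    qed
  qed
  then show ?thesis using walk by blast
qed

end

section \<open>From the graph definitions to rooted trees\<close>

lemma valence_eq_card: "valence G x = card {y. (x, y) \<in> parcs G}"
proof -
  have "out_arcs (with_proj G) x = Pair x ` {y. (x, y) \<in> parcs G}"
    by (auto simp: out_arcs_def)
  then show ?thesis
    by (simp add: out_degree_def card_image inj_on_def)
qed

lemma infinite_graph_imp_locally_finite_graph:
  assumes "infinite_graph G"
  shows "locally_finite_graph G"
proof -
  interpret pair_bidirected_digraph G
    using assms by (simp add: infinite_graph_def)
  show ?thesis
  proof
    fix x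
    show "finite {y. (x, y) \<in> parcs G}"
    proof (cases "x \<in> pverts G")
      case True
      then have "finite (snd ` out_arcs (with_proj G) x)"
        using assms by (simp add: infinite_graph_def)
      then show ?thesis
        by (rule rev_finite_subset) (force simp: out_arcs_def)
    next
      case False
      then have "{y. (x, y) \<in> parcs G} = {}" using in_arcsD1 by auto
      then show ?thesis by (simp only: finite.emptyI)
    qed
  qed
qed

text \<open>Connectedness refers to the symmetric closure, which adds nothing to symmetric
  arcs.\<close>

lemma infinite_graph_connected:
  assumes G: "infinite_graph G" and xy: "x \<in> pverts G" "y \<in> pverts G"
  shows "(x, y) \<in> (parcs G)\<^sup>*"
proof -
  interpret pair_bidirected_digraph G
    using G by (simp add: infinite_graph_def)
  have "x \<rightarrow>\<^sup>*\<^bsub>with_proj (mk_symmetric (with_proj G))\<^esub> y"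
    using G xy unfolding infinite_graph_def Digraph_Component.connected_def strongly_connected_def
    by simp
  then have "(x, y) \<in> rtrancl_on (pverts G) (parcs G)"
    using reachable_mk_symmetric_eq[of x y] pair_sym_arcs by (simp add: reachable_def)
  then show ?thesis
    by (induction rule: rtrancl_on_induct) (auto intro: rtrancl_into_rtrancl)
qed

lemma infinite_tree_imp_rooted_tree:
  assumes "infinite_tree G" "x0 \<in> pverts G"
  shows "rooted_tree G x0"
proof -
  have G: "infinite_graph G" using assms(1) by (simp add: infinite_tree_def)
  interpret locally_finite_graph G using infinite_graph_imp_locally_finite_graph[OF G] .
  have "pair_bidirected_digraph G" using G by (simp add: infinite_graph_def)
  then interpret loopfree: pair_loopfree_digraph G by (simp add: pair_bidirected_digraph_def)
  show ?thesis
  proof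
    show "(x, x) \<notin> parcs G" for x using loopfree.pair_no_loops by force
    show "cycle p \<Longrightarrow> length p < 3" for p
      using assms(1) unfolding infinite_tree_def by (meson not_le)
  qed (use assms(2) infinite_graph_connected[OF G] in auto)
qed

section \<open>The radial solution on a model tree\<close>

text \<open>The equation \<Delta> v + v = 0 at depth r, solved for the value at depth r + 1: a
  vertex there has \<open>n r\<close> children and, unless it is the root, one parent.\<close>

fun radial :: "(nat \<Rightarrow> nat) \<Rightarrow> nat \<Rightarrow> real" where
  "radial n 0 = 1"
| "radial n (Suc 0) = 1 + 1 / real (n 0)"
| "radial n (Suc (Suc r)) =
    radial n (Suc r) + (2 * radial n (Suc r) - radial n r) / real (n (Suc r))"

text \<open>Both claims are proved together: positivity and monotonicity up to \<open>Suc r\<close>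
  make the next increment nonnegative.\<close>

lemma radial_step: "1 \<le> radial n r \<and> radial n r \<le> radial n (Suc r)"
proof (induction r)
  case (Suc r)
  then have "0 \<le> 2 * radial n (Suc r) - radial n r" by linarith
  then show ?case using Suc by simp
qed simp

lemma radial_mono: "mono (radial n)"
  using radial_step by (simp add: mono_iff_le_Suc)

lemma radial_ge_1: "1 \<le> radial n r"
  using radial_step by blast

text \<open>The recursion with at most \<open>n r\<close> children, whose increments are
  nonnegative. At the root the missing parent value is replaced by 1, so that the right side equals
  \<open>radial n 0\<close>.\<close>

lemma radial_diff_le:
  assumes "k \<le> n r"
  shows "real k * (radial n (Suc r) - radial n r) \<le>
    2 * radial n r - (if r = 0 then 1 else radial n (r - 1))"
proof (cases "n r = 0")
  case True
  have "(if r = 0 then 1 else radial n (r - 1)) \<le> radial n r"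
    using monoD[OF radial_mono, of "r - 1" r n] by simp
  then show ?thesis
    using assms True radial_ge_1[of n r] by simp
next
  case False
  have "real k * (radial n (Suc r) - radial n r) \<le> real (n r) * (radial n (Suc r) - radial n r)"
    using assms radial_step[of n r] by (intro mult_right_mono) auto
  also have "\<dots> = 2 * radial n r - (if r = 0 then 1 else radial n (r - 1))"
    using False by (cases r) auto
  finally show ?thesis .
qed

lemma radial_diff_eq:
  assumes "0 < n r"
  shows "real (n r) * (radial n (Suc r) - radial n r) =
    2 * radial n r - (if r = 0 then 1 else radial n (r - 1))"
  using assms by (cases r) auto

lemma model_tree_card_nbrs:
  assumes model: "model_tree G x0 n" and x: "x \<in> pverts G"
  shows "n (graph_dist G x x0) =
    (if x = x0 then card {y. (x, y) \<in> parcs G} else card {y. (x, y) \<in> parcs G} - 1)"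
proof -
  interpret rooted_tree G x0
    using model by (intro infinite_tree_imp_rooted_tree) (auto simp: model_tree_def)
  obtain m where m: "\<And>r x. x \<in> graph_sphere G x0 r \<Longrightarrow> valence G x = m r"
      "\<And>r. n r = (if r = 0 then m 0 else m r - 1)"
    using model unfolding model_tree_def by blast
  have "valence G x = m (depth x)"
    using x by (intro m(1)) (simp add: graph_sphere_def)
  then show ?thesis
    using m(2)[of "depth x"] depth_eq_0_iff[OF x] by (auto simp: valence_eq_card)
qed

text \<open>Some vertex at depth \<open>Suc r\<close> exists, and its parent has a child. If that
  parent is not the root, it also has a parent of its own and thus valence at least 2.\<close>

lemma model_tree_branching_pos:
  assumes model: "model_tree G x0 n"
  shows "0 < n r"
proof -
  interpret rooted_tree G x0
    using model by (intro infinite_tree_imp_rooted_tree) (auto simp: model_tree_def)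
  have "infinite (pverts G)"
    using model by (simp add: model_tree_def infinite_tree_def infinite_graph_def)
  then obtain x where x: "x \<in> pverts G" "depth x = Suc r" using ex_depth by blast
  then have "x \<noteq> x0" using depth_root by auto
  with x obtain y where y: "(x, y) \<in> parcs G" "depth y = r" using parent_exists by force
  have yV: "y \<in> pverts G" using in_arcsD2[OF y(1)] .
  have yx: "x \<in> nbrs y" using y(1) arc_sym by auto
  show ?thesis
  proof (cases "y = x0")
    case True
    then show ?thesis
      using model_tree_card_nbrs[OF model yV] y(2) yx finite_nbrs[of y] card_gt_0_iff by auto
  next
    case False
    then obtain a where a: "a \<in> nbrs y" "depth y = Suc (depth a)" using parent_exists yV by auto
    then have "a \<noteq> x" using x(2) y(2) by auto
    then have "card {a, x} = 2" by simp
    moreover have "card {a, x} \<le> card (nbrs y)"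
      using a(1) yx by (intro card_mono finite_nbrs) auto
    ultimately show ?thesis
      using model_tree_card_nbrs[OF model yV] y(2) False by simp
  qed
qed

theorem corollary3p3p2:
  fixes Tn T :: "'a pair_pre_digraph" and x0 :: 'a and n :: "nat \<Rightarrow> nat"
  assumes "model_tree Tn x0 n"
    and "infinite_tree T"
    and "subgraph (with_proj T) (with_proj Tn)"
    and "x0 \<in> pverts T"
    and "stochastically_complete Tn"
  shows "stochastically_complete T"
proof -
  interpret Tn: rooted_tree Tn x0
    using assms(1) by (intro infinite_tree_imp_rooted_tree) (auto simp: model_tree_def)
  have T: "infinite_graph T" using assms(2) by (simp add: infinite_tree_def)
  interpret T: locally_finite_graph T using infinite_graph_imp_locally_finite_graph[OF T] .
  have sub: "pverts T \<subseteq> pverts Tn" "parcs T \<subseteq> parcs Tn"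
    using assms(3) by (auto simp: subgraph_def)
  let ?d = "\<lambda>x. graph_dist Tn x x0"
  define f where "f x = radial n (?d x)" for x
  have f_ge_1: "1 \<le> f x" for x by (simp add: f_def radial_ge_1)
  interpret Tn: exhausted_graph Tn "\<lambda>k. {x \<in> pverts Tn. ?d x < k}"
    by unfold_locales (auto intro: Tn.finite_depth_less simp: incseq_def)
  \<comment> \<open>Depth is measured in the model tree, since \<open>f\<close> is radial
    there.\<close>
  interpret T: exhausted_graph T "\<lambda>k. {x \<in> pverts T. ?d x < k}"
  proof
    show "finite {x \<in> pverts T. ?d x < k}" for k
      using sub by (intro finite_subset[OF _ Tn.finite_depth_less[of k]]) auto
  qed (auto simp: incseq_def)
  have unbounded: "\<not> bdd_above (range (radial n))"
  proof
    assume bdd: "bdd_above (range (radial n))"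
    have "stochastically_incomplete Tn"
    proof (rule Tn.stochastically_incomplete_if_bounded_subsolution[of f x0])
      show "bdd_above (f ` pverts Tn)"
        using bdd by (rule bdd_above_mono) (auto simp: f_def)
      fix x assume x: "x \<in> pverts Tn"
      show "laplacian Tn f x + f x \<le> 0"
      proof (cases "x = x0")
        case True
        then show ?thesis
          using Tn.sum_radial_diff_root[of "Tn.nbrs x0" "radial n"] Tn.depth_root
            model_tree_card_nbrs[OF assms(1) x] radial_diff_eq[of n 0]
            model_tree_branching_pos[OF assms(1), of 0]
          by (simp add: laplacian_def f_def)
      next
        case False
        then obtain a where a: "a \<in> Tn.nbrs x" "?d x = Suc (?d a)" using Tn.parent_exists x by auto
        then show ?thesis
          using Tn.sum_radial_diff[OF Tn.finite_nbrs subset_refl a, of "radial n"]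
            model_tree_card_nbrs[OF assms(1) x] radial_diff_eq[of n "?d x"]
            model_tree_branching_pos[OF assms(1), of "?d x"] False
          by (simp add: laplacian_def f_def)
      qed
    qed (use f_ge_1 Tn.root in \<open>auto intro: order_trans[OF zero_le_one] less_le_trans[OF zero_less_one]\<close>)
    with assms(5) show False by (simp add: stochastically_complete_def)
  qed
  show ?thesis
  proof (rule T.stochastically_complete_if_exhaustive_supersolution[of f])
    show "0 \<le> f x" for x using f_ge_1 by (rule order_trans[OF zero_le_one])
  next
    fix C
    from unbounded obtain k where "C \<le> radial n k"
      by (meson bdd_aboveI2 linear)
    \<comment> \<open>Monotonicity carries one large value of \<open>radial n\<close> to all greater
      depths.\<close>
    then have "C \<le> f x" if "k \<le> ?d x" for x
      using monoD[OF radial_mono that, of n] by (simp add: f_def)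
    then show "\<exists>k. \<forall>x\<in>pverts T - {x \<in> pverts T. ?d x < k}. C \<le> f x"
      using not_less by blast
  next
    fix x assume x: "x \<in> pverts T"
    have N: "T.nbrs x \<subseteq> Tn.nbrs x" and xn: "x \<in> pverts Tn" using sub x by auto
    have card: "card (T.nbrs x) \<le> card (Tn.nbrs x)"
      using N Tn.finite_nbrs by (intro card_mono)
    show "0 \<le> laplacian T f x + f x"
    proof (cases "x = x0")
      case True
      then show ?thesis
        using Tn.sum_radial_diff_root[of "T.nbrs x0" "radial n"] N Tn.depth_root card
          model_tree_card_nbrs[OF assms(1) xn] radial_diff_le[of "card (T.nbrs x)" n 0]
        by (simp add: laplacian_def f_def)
    next
      case False
      \<comment> \<open>The subtree is connected and contains the root, so it keeps the parent of
        \<open>x\<close>.\<close>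
      then obtain a where a: "a \<in> T.nbrs x" "?d x = Suc (?d a)"
        using Tn.parent_in_subgraph[OF sub(2) infinite_graph_connected[OF T x assms(4)]] by auto
      \<comment> \<open>Subtracting the parent leaves the children in the subtree; having fewer of
        them can only raise the Laplacian of the nondecreasing \<open>f\<close>.\<close>
      have "card (T.nbrs x) - 1 \<le> n (?d x)"
        using card False model_tree_card_nbrs[OF assms(1) xn] by simp
      from radial_diff_le[of "card (T.nbrs x) - 1" n "?d x", OF this]
      have "real (card (T.nbrs x) - 1) * (radial n (Suc (?d x)) - radial n (?d x))
          \<le> 2 * radial n (?d x) - radial n (?d x - 1)"
        using a(2) by (simp del: radial.simps)
      then show ?thesis
        using Tn.sum_radial_diff[OF T.finite_nbrs N a, of "radial n"]
        unfolding laplacian_def f_def by linarith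
    qed
  qed
qed

end
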